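(* Let $(\lambda_n^b)_{n\ge 0}$ be positive numbers with $1+\sum_{i=0}^\infty\lambda_0^b\lambda_1^b\cdots\lambda_i^b<\infty$, and let $b(n,\boldsymbol{\theta})$ be the corresponding stationary (base) distribution. Let $\mathcal{F}=\{n_0,\dots,n_m\}\subseteq\{0,1,\dots,q\}$ (with $n_0,\dots,n_m$ distinct), let $0<\alpha_n<\infty$ for $n\in\mathcal{F}$, and put $$\lambda_n=\begin{cases}\dfrac{\alpha_{n+1}^{\mathbf{1}_{\mathcal{F}}(n+1)}}{\alpha_n^{\mathbf{1}_{\mathcal{F}}(n)}}\lambda_n^b,& n=0,1,\dots,q-1,\\[2mm] \dfrac{1}{\alpha_q^{\mathbf{1}_{\mathcal{F}}(q)}}\lambda_q^b,&n=q,\\[2mm] \lambda_n^b,&n>q.\end{cases}$$ Then the stationary distribution of the birth-death process with birth-death-rate ratios $\lambda_n$ is $$p(n,\boldsymbol{\theta},\boldsymbol{\alpha})=\frac{\Bigl(\prod_{i=0}^m\alpha_{n_i}^{\mathbf{1}_{n_i}(n)}\Bigr)\,b(n,\boldsymbol{\theta})}{z(\boldsymbol{\theta},\boldsymbol{\alpha})},\qquad z(\boldsymbol{\theta},\boldsymbol{\alpha})=1+\sum_{i=0}^m(\alpha_{n_i}-1)\,b(n_i,\boldsymbol{\theta}),\qquad n=0,1,2,\dots$$ where $\boldsymbol{\alpha}=[\alpha_{n_0},\dots,\alpha_{n_m}]$.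
   Context: For a birth-death process on $\{0,1,2,\dots\}$ with birth rates $\gamma_n$ ($n\ge0$) and death rates $\mu_n$ ($n\ge1$), the birth-death-rate ratios are $\lambda_n=\gamma_n/\mu_{n+1}>0$. When $1+\sum_{i=0}^\infty\lambda_0\lambda_1\cdots\lambda_i<\infty$, the stationary distribution is $p_0=\bigl(1+\sum_{i=0}^\infty\lambda_0\lambda_1\cdots\lambda_i\bigr)^{-1}$ and $p_n=\lambda_0\lambda_1\cdots\lambda_{n-1}p_0$ for $n>0$. The base distribution $b(n,\boldsymbol{\theta})$ is the one obtained this way from the ratios $\lambda_n^b$ (which depend on a parameter vector $\boldsymbol{\theta}$). Indicators: $\mathbf{1}_{\mathcal{F}}(n)=1$ if $n\in\mathcal{F}$ and $0$ otherwise; $\mathbf{1}_{n_i}(n)=1$ if $n=n_i$ and $0$ otherwise; when $n\notin\mathcal{F}$, $\alpha_n^{\mathbf{1}_{\mathcal{F}}(n)}$ is read as $1$. *)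

theory Defs
  imports Complex_Main "HOL-Library.Indicator_Function"
begin

text \<open>
  Birth rates \<open>\<gamma> n\<close> are used for \<open>n \<ge> 0\<close>, death rates \<open>\<mu> n\<close> only for \<open>n \<ge> 1\<close>;
  the value \<open>\<mu> 0\<close> is ignored throughout.
\<close>

definition bd_rates :: "(nat \<Rightarrow> real) \<Rightarrow> (nat \<Rightarrow> real) \<Rightarrow> bool" where
  "bd_rates \<gamma> \<mu> \<longleftrightarrow> (\<forall>n. 0 < \<gamma> n) \<and> (\<forall>n\<ge>1. 0 < \<mu> n)"

definition bd_ratio :: "(nat \<Rightarrow> real) \<Rightarrow> (nat \<Rightarrow> real) \<Rightarrow> nat \<Rightarrow> real" where
  "bd_ratio \<gamma> \<mu> n = \<gamma> n / \<mu> (n + 1)"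

definition bd_generator :: "(nat \<Rightarrow> real) \<Rightarrow> (nat \<Rightarrow> real) \<Rightarrow> nat \<Rightarrow> nat \<Rightarrow> real" where
  "bd_generator \<gamma> \<mu> i j =
     (if j = i + 1 then \<gamma> i
      else if i = j + 1 then \<mu> i
      else if i = j then - (\<gamma> i + (if i = 0 then 0 else \<mu> i))
      else 0)"

text \<open>
  Stationarity is the global balance condition: a probability vector annihilated by the
  generator from the left.
\<close>

definition bd_stationary :: "(nat \<Rightarrow> real) \<Rightarrow> (nat \<Rightarrow> real) \<Rightarrow> (nat \<Rightarrow> real) \<Rightarrow> bool" where
  "bd_stationary \<gamma> \<mu> p \<longleftrightarrow>
     (\<forall>n. 0 \<le> p n) \<and> p sums 1 \<and> (\<forall>j. (\<lambda>i. p i * bd_generator \<gamma> \<mu> i j) sums 0)"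

text \<open>
  For positive ratios, \<open>bd_summable\<close> says that the series
  \<open>1 + l 0 + l 0 * l 1 + \<dots>\<close> is finite; \<open>bd_pmf\<close> is meaningful only in that case.
\<close>

definition bd_summable :: "(nat \<Rightarrow> real) \<Rightarrow> bool" where
  "bd_summable l \<longleftrightarrow> summable (\<lambda>i. \<Prod>j\<le>i. l j)"

definition bd_p0 :: "(nat \<Rightarrow> real) \<Rightarrow> real" where
  "bd_p0 l = inverse (1 + (\<Sum>i. \<Prod>j\<le>i. l j))"

definition bd_pmf :: "(nat \<Rightarrow> real) \<Rightarrow> nat \<Rightarrow> real" where
  "bd_pmf l n = (if n = 0 then bd_p0 l else (\<Prod>j<n. l j) * bd_p0 l)"

text \<open>
  The exponents are natural-number indicators, so \<open>\<alpha> n ^ indicator F n\<close> is \<open>1\<close> for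
  \<open>n \<notin> F\<close> whatever value \<open>\<alpha>\<close> takes there.
\<close>

definition modified_ratio ::
    "nat \<Rightarrow> nat set \<Rightarrow> (nat \<Rightarrow> real) \<Rightarrow> (nat \<Rightarrow> real) \<Rightarrow> nat \<Rightarrow> real" where
  "modified_ratio q F \<alpha> l n =
     (if n < q then \<alpha> (n + 1) ^ (indicator F (n + 1) :: nat) / \<alpha> n ^ (indicator F n :: nat) * l n
      else if n = q then 1 / \<alpha> q ^ (indicator F q :: nat) * l q
      else l n)"

definition modified_norm ::
    "nat \<Rightarrow> (nat \<Rightarrow> nat) \<Rightarrow> (nat \<Rightarrow> real) \<Rightarrow> (nat \<Rightarrow> real) \<Rightarrow> real" where
  "modified_norm m ns \<alpha> b = 1 + (\<Sum>i=0..m. (\<alpha> (ns i) - 1) * b (ns i))"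

definition modified_pmf ::
    "nat \<Rightarrow> (nat \<Rightarrow> nat) \<Rightarrow> (nat \<Rightarrow> real) \<Rightarrow> (nat \<Rightarrow> real) \<Rightarrow> nat \<Rightarrow> real" where
  "modified_pmf m ns \<alpha> b n =
     (\<Prod>i=0..m. \<alpha> (ns i) ^ (indicator {ns i} n :: nat)) * b n / modified_norm m ns \<alpha> b"

end

(* Since F lies in {0..q}, all three cases of the modified ratio read a(n+1) / a(n) * lb(n), where
   a(n) is alpha(n) on F and 1 elsewhere.  The partial products therefore telescope: the
   unnormalised weights are multiplied by a(n) / a(0), which differs from the constant 1 / a(0)
   only on the finite set F.  Stationarity is equivalent to detailed balance, because the global
   balance equation at j says that the net flux across the edge (j, j+1) equals that across
   (j-1, j), and there is no flux into 0 from the left. *)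

theory Submission
  imports Defs
begin

text \<open>Shifting the index by one preserves convergence. From here on the weights are
  \<open>\<Prod>j<n. l j\<close>, starting with the empty product at \<open>n = 0\<close>.\<close>

lemma bd_summable_iff: "bd_summable l \<longleftrightarrow> summable (\<lambda>n. \<Prod>j<n. l j)"
  unfolding bd_summable_def
  using summable_Suc_iff[of "\<lambda>n. \<Prod>j<n. l j"] by (simp only: lessThan_Suc_atMost)

text \<open>The empty product accounts both for the leading 1 in \<open>bd_p0\<close> and for the
  separate case at 0 in \<open>bd_pmf\<close>.\<close>

lemma bd_pmf_eq:
  assumes "bd_summable l"
  shows "bd_pmf l n = (\<Prod>j<n. l j) / (\<Sum>k. \<Prod>j<k. l j)"
proof -
  have "(\<Sum>k. \<Prod>j<k. l j) = 1 + (\<Sum>i. \<Prod>j\<le>i. l j)"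
    using suminf_split_head[OF assms[unfolded bd_summable_iff]]
    by (simp only: lessThan_Suc_atMost) simp
  then show ?thesis
    by (simp add: bd_pmf_def bd_p0_def divide_inverse)
qed

lemma suminf_prod_pos:
  fixes l :: "nat \<Rightarrow> real"
  assumes "bd_summable l" and "\<And>n. 0 < l n"
  shows "0 < (\<Sum>k. \<Prod>j<k. l j)"
  using assms by (auto simp: bd_summable_iff intro!: suminf_pos prod_pos)

lemma bd_pmf_sums_1:
  assumes "bd_summable l" and "\<And>n. 0 < l n"
  shows "bd_pmf l sums 1"
proof -
  have "(\<lambda>n. (\<Prod>j<n. l j) / (\<Sum>k. \<Prod>j<k. l j)) sums ((\<Sum>k. \<Prod>j<k. l j) / (\<Sum>k. \<Prod>j<k. l j))"
    using assms(1) by (intro sums_divide summable_sums) (simp add: bd_summable_iff)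
  then show ?thesis
    using less_imp_neq[OF suminf_prod_pos[OF assms]] by (simp add: bd_pmf_eq[OF assms(1), abs_def])
qed

text \<open>Column \<open>j\<close> of the generator vanishes off the neighbours of
  \<open>j\<close>, so the series is a finite sum. It is grouped as a difference of net fluxes
  across the two edges at \<open>j\<close>.\<close>

lemma bd_generator_sums:
  "(\<lambda>i. p i * bd_generator \<gamma> \<mu> i j) sums
     (p (j + 1) * \<mu> (j + 1) - p j * \<gamma> j
       - (if j = 0 then 0 else p j * \<mu> j - p (j - 1) * \<gamma> (j - 1)))"
proof -
  have "(\<lambda>i. p i * bd_generator \<gamma> \<mu> i j) sums (\<Sum>i\<in>{j - 1..j + 1}. p i * bd_generator \<gamma> \<mu> i j)"
    by (rule sums_finite) (auto simp: bd_generator_def)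
  \<comment> \<open>At \<open>j = 0\<close> truncated subtraction gives \<open>j - 1 = 0\<close>, so
    the range has only two points.\<close>
  moreover have "{j - 1..j + 1} = (if j = 0 then {0, 1} else {j - 1, j, j + 1})"
    by auto
  ultimately show ?thesis
    by (cases j) (simp_all add: bd_generator_def algebra_simps)
qed

lemma global_balance_iff_detailed_balance:
  "(\<forall>j. (\<lambda>i. p i * bd_generator \<gamma> \<mu> i j) sums 0) \<longleftrightarrow>
     (\<forall>n. p (n + 1) * \<mu> (n + 1) = p n * \<gamma> n)" (is "?G \<longleftrightarrow> ?D")
proof
  assume ?G
  then have flux: "p (j + 1) * \<mu> (j + 1) - p j * \<gamma> j =
      (if j = 0 then 0 else p j * \<mu> j - p (j - 1) * \<gamma> (j - 1))" for j
    using sums_unique2[OF bd_generator_sums[of p \<gamma> \<mu> j]] by fastforce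
  have "p (n + 1) * \<mu> (n + 1) = p n * \<gamma> n" for n
  proof (induction n)
    case 0
    then show ?case using flux[of 0] by simp
  next
    case (Suc n)
    then show ?case using flux[of "Suc n"] by simp
  qed
  then show ?D ..
next
  assume D: ?D
  show ?G
  proof
    fix j
    show "(\<lambda>i. p i * bd_generator \<gamma> \<mu> i j) sums 0"
      using bd_generator_sums[of p \<gamma> \<mu> j] D by (cases j) simp_all
  qed
qed

text \<open>Detailed balance is a first-order recursion, which determines \<open>p\<close> up to the
  factor \<open>p 0\<close>; total mass 1 then fixes \<open>p 0\<close>. This gives uniqueness as
  well as existence.\<close>

lemma bd_stationary_iff_bd_pmf:
  assumes rates: "bd_rates \<gamma> \<mu>" and summable: "bd_summable (bd_ratio \<gamma> \<mu>)"
  shows "bd_stationary \<gamma> \<mu> p \<longleftrightarrow> p = bd_pmf (bd_ratio \<gamma> \<mu>)"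
proof
  let ?l = "bd_ratio \<gamma> \<mu>"
  let ?W = "\<Sum>k. \<Prod>j<k. ?l j"
  have mu: "0 < \<mu> (n + 1)" and l: "0 < ?l n" for n
    using rates by (auto simp: bd_rates_def bd_ratio_def)
  have W: "0 < ?W" by (rule suminf_prod_pos[OF summable l])
  {
    assume "bd_stationary \<gamma> \<mu> p"
    then have one: "p sums 1" and balance: "p (n + 1) * \<mu> (n + 1) = p n * \<gamma> n" for n
      unfolding bd_stationary_def global_balance_iff_detailed_balance by auto
    have p: "p n = p 0 * (\<Prod>j<n. ?l j)" for n
    proof (induction n)
      case (Suc n)
      have "p (Suc n) = p n * ?l n"
        using balance[of n] mu[of n] by (simp add: bd_ratio_def field_simps)
      with Suc show ?case by simp
    qed simp
    have "(\<lambda>n. p 0 * (\<Prod>j<n. ?l j)) sums (p 0 * ?W)"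
      using summable by (intro sums_mult summable_sums) (simp add: bd_summable_iff)
    then have "p sums (p 0 * ?W)"
      by (simp only: p[symmetric])
    with one have "p 0 * ?W = 1"
      using sums_unique2 by blast
    with W have "p 0 = 1 / ?W"
      by (simp add: field_simps)
    then show "p = bd_pmf ?l"
      using p bd_pmf_eq[OF summable] by (metis mult.commute mult_1 times_divide_eq_right ext)
  next
    assume p: "p = bd_pmf ?l"
    have "0 \<le> p n" for n
      using W l unfolding p bd_pmf_eq[OF summable]
      by (intro divide_nonneg_pos prod_nonneg) (auto intro: less_imp_le)
    moreover have "p (n + 1) * \<mu> (n + 1) = p n * \<gamma> n" for n
      using mu[of n] unfolding p bd_pmf_eq[OF summable] by (simp add: bd_ratio_def)
    ultimately show "bd_stationary \<gamma> \<mu> p"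
      unfolding bd_stationary_def global_balance_iff_detailed_balance
      using bd_pmf_sums_1[OF summable l] p by auto
  }
qed

lemma modified_ratio_eq:
  assumes "F \<subseteq> {0..q}"
  shows "modified_ratio q F \<alpha> l n =
    \<alpha> (n + 1) ^ (indicator F (n + 1) :: nat) / \<alpha> n ^ (indicator F n :: nat) * l n"
proof -
  \<comment> \<open>For \<open>n = q\<close> this turns the numerator into 1, and for
    \<open>n > q\<close> the denominator as well.\<close>
  have "indicator F k = (0 :: nat)" if "q < k" for k
    using assms that by (auto simp: indicator_def)
  then show ?thesis
    by (simp add: modified_ratio_def)
qed

lemma prod_modified_ratio:
  assumes F: "F \<subseteq> {0..q}" and pos: "\<forall>n\<in>F. 0 < \<alpha> n"
  shows "(\<Prod>j<n. modified_ratio q F \<alpha> l j) =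
    \<alpha> n ^ (indicator F n :: nat) * (\<Prod>j<n. l j) / \<alpha> 0 ^ (indicator F 0 :: nat)"
proof -
  define a where "a k = \<alpha> k ^ (indicator F k :: nat)" for k
  \<comment> \<open>Off \<open>F\<close> the exponent is 0 and \<open>a k = 1\<close> whatever the
    sign of \<open>\<alpha> k\<close>, so positivity on \<open>F\<close> suffices.\<close>
  have nz: "a k \<noteq> 0" for k
    using pos by (auto simp: a_def indicator_def)
  have ratio: "modified_ratio q F \<alpha> l k = a (k + 1) / a k * l k" for k
    unfolding a_def by (rule modified_ratio_eq[OF F])
  have "(\<Prod>j<n. modified_ratio q F \<alpha> l j) = a n * (\<Prod>j<n. l j) / a 0"
  proof (induction n)
    case 0
    then show ?case using nz[of 0] by simp
  next
    case (Suc n)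
    then show ?case using nz[of n] by (simp add: ratio)
  qed
  then show ?thesis
    by (simp only: a_def)
qed

text \<open>The new weights are \<open>w\<close> plus a correction supported on the finite set
  \<open>F\<close>, which cannot affect convergence and adds a finite sum to the total.\<close>

lemma perturbed_weights_sums:
  fixes \<alpha> w :: "nat \<Rightarrow> real"
  assumes F: "finite F" and w: "summable w"
  shows "(\<lambda>n. \<alpha> n ^ (indicator F n :: nat) * w n) sums (suminf w + (\<Sum>n\<in>F. (\<alpha> n - 1) * w n))"
proof -
  have "(\<lambda>n. if n \<in> F then (\<alpha> n - 1) * w n else 0) sums (\<Sum>n\<in>F. (\<alpha> n - 1) * w n)"
    by (rule sums_If_finite_set[OF F])
  from sums_add[OF summable_sums[OF w] this] show ?thesis
    by (rule sums_cong[THEN iffD1, rotated]) (auto simp: indicator_def algebra_simps)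
qed

text \<open>The constant \<open>1 / a(0)\<close> left by telescoping is common to every weight and
  to their total, so it cancels on normalising.\<close>

lemma bd_pmf_modified_ratio:
  assumes summable: "bd_summable l" and l: "\<And>n. 0 < l n"
    and F: "F \<subseteq> {0..q}" and pos: "\<forall>n\<in>F. 0 < \<alpha> n"
  shows "bd_summable (modified_ratio q F \<alpha> l)"
    and "bd_pmf (modified_ratio q F \<alpha> l) n =
      \<alpha> n ^ (indicator F n :: nat) * bd_pmf l n / (1 + (\<Sum>k\<in>F. (\<alpha> k - 1) * bd_pmf l k))"
proof -
  let ?a = "\<lambda>n. \<alpha> n ^ (indicator F n :: nat)"
  let ?w = "\<lambda>n. \<Prod>j<n. l j"
  let ?D = "\<Sum>k\<in>F. (\<alpha> k - 1) * ?w k"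
  have W: "0 < suminf ?w"
    by (rule suminf_prod_pos[OF summable l])
  have a0: "?a 0 \<noteq> 0"
    using pos by (auto simp: indicator_def)
  have "finite F"
    using F finite_subset by blast
  then have "(\<lambda>n. ?a n * ?w n) sums (suminf ?w + ?D)"
    using summable by (intro perturbed_weights_sums) (simp_all add: bd_summable_iff)
  then have S: "(\<lambda>n. \<Prod>j<n. modified_ratio q F \<alpha> l j) sums ((suminf ?w + ?D) / ?a 0)"
    by (simp only: prod_modified_ratio[OF F pos] sums_divide)
  then show summable': "bd_summable (modified_ratio q F \<alpha> l)"
    by (auto simp: bd_summable_iff sums_iff)
  have "bd_pmf (modified_ratio q F \<alpha> l) n = (?a n * ?w n / ?a 0) / ((suminf ?w + ?D) / ?a 0)"
    unfolding bd_pmf_eq[OF summable'] sums_unique[OF S, symmetric]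
    by (simp only: prod_modified_ratio[OF F pos])
  also have "\<dots> = ?a n * ?w n / (suminf ?w + ?D)"
    using a0 by simp
  \<comment> \<open>Dividing through by the base total turns weights into base probabilities and
    produces the leading 1 of the normaliser.\<close>
  also have "\<dots> = (?a n * ?w n / suminf ?w) / ((suminf ?w + ?D) / suminf ?w)"
    using W by simp
  also have "(suminf ?w + ?D) / suminf ?w = 1 + (\<Sum>k\<in>F. (\<alpha> k - 1) * bd_pmf l k)"
    using W by (simp add: bd_pmf_eq[OF summable] add_divide_distrib sum_divide_distrib)
  finally show "bd_pmf (modified_ratio q F \<alpha> l) n =
      ?a n * bd_pmf l n / (1 + (\<Sum>k\<in>F. (\<alpha> k - 1) * bd_pmf l k))"
    by (simp add: bd_pmf_eq[OF summable])
qed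

text \<open>Distinctness of the \<open>ns i\<close> lets the product and the sum be reindexed over
  \<open>F\<close>; in the product only the factor at \<open>k = n\<close> can differ from
  1.\<close>

lemma modified_pmf_eq:
  assumes F: "F = ns ` {0..m}" and inj: "inj_on ns {0..m}"
  shows "modified_pmf m ns \<alpha> b n =
    \<alpha> n ^ (indicator F n :: nat) * b n / (1 + (\<Sum>k\<in>F. (\<alpha> k - 1) * b k))"
proof -
  have "(\<Prod>i=0..m. \<alpha> (ns i) ^ (indicator {ns i} n :: nat)) =
      (\<Prod>k\<in>F. \<alpha> k ^ (indicator {k} n :: nat))"
    unfolding F by (simp add: prod.reindex[OF inj])
  also have "\<dots> = (\<Prod>k\<in>F. if k = n then \<alpha> k else 1)"
    by (intro prod.cong) (auto simp: indicator_def)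
  also have "\<dots> = \<alpha> n ^ (indicator F n :: nat)"
    using F by (simp add: indicator_def)
  finally show ?thesis
    by (simp add: modified_pmf_def modified_norm_def F sum.reindex[OF inj])
qed

theorem mainTheorem2:
  fixes lb :: "'t \<Rightarrow> nat \<Rightarrow> real" and \<theta> :: 't
    and \<alpha> \<gamma> \<mu> :: "nat \<Rightarrow> real"
    and q m :: nat and ns :: "nat \<Rightarrow> nat" and F :: "nat set"
  assumes base_pos: "\<forall>n. 0 < lb \<theta> n"
    and base_summable: "bd_summable (lb \<theta>)"
    and F_enum: "F = ns ` {0..m}" and ns_distinct: "inj_on ns {0..m}"
    and F_bounded: "F \<subseteq> {0..q}"
    and alpha_pos: "\<forall>n\<in>F. 0 < \<alpha> n"
    and rates: "bd_rates \<gamma> \<mu>"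
    and ratios: "\<forall>n. bd_ratio \<gamma> \<mu> n = modified_ratio q F \<alpha> (lb \<theta>) n"
  shows "bd_summable (modified_ratio q F \<alpha> (lb \<theta>))
    \<and> (\<forall>n. bd_pmf (modified_ratio q F \<alpha> (lb \<theta>)) n = modified_pmf m ns \<alpha> (bd_pmf (lb \<theta>)) n)
    \<and> (\<forall>p. bd_stationary \<gamma> \<mu> p \<longleftrightarrow> (\<forall>n. p n = modified_pmf m ns \<alpha> (bd_pmf (lb \<theta>)) n))"
proof -
  let ?l = "modified_ratio q F \<alpha> (lb \<theta>)"
  have summable: "bd_summable ?l"
    and pmf: "bd_pmf ?l n = modified_pmf m ns \<alpha> (bd_pmf (lb \<theta>)) n" for n
    using bd_pmf_modified_ratio[OF base_summable _ F_bounded alpha_pos] base_pos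
    by (simp_all add: modified_pmf_eq[OF F_enum ns_distinct])
  \<comment> \<open>As an equality of functions this rewrites the characterisation of stationary
    vectors into one by \<open>bd_pmf ?l\<close>, where \<open>pmf\<close> applies.\<close>
  have ratio: "bd_ratio \<gamma> \<mu> = ?l"
    using ratios by auto
  have "bd_stationary \<gamma> \<mu> p \<longleftrightarrow> (\<forall>n. p n = modified_pmf m ns \<alpha> (bd_pmf (lb \<theta>)) n)" for p
    using bd_stationary_iff_bd_pmf[OF rates, unfolded ratio, OF summable] pmf
    by (simp add: fun_eq_iff)
  with summable pmf show ?thesis
    by blast
qed

end
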